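(* There exist absolute positive constants $c$ and $C$ such that for every integer $d\geqslant 2$ and every sequence of complex numbers $\mathbf a=(a_n)_{n=1}^\infty$ with $|a_n|=1$ for all $n$, the set $$\mathcal E_{\mathbf a,c,C}(d)=\Big\{\mathbf x=(x_1,\ldots,x_d)\in[0,1)^d:~ cN^{1/2}\leqslant \Big|\sum_{n=1}^N a_n\,\mathbf e(x_1n+\cdots+x_dn^d)\Big|\leqslant CN^{1/2}\ \text{for infinitely many } N\in\mathbb N\Big\}$$ has $d$-dimensional Lebesgue measure $1$.
   Context: $\mathbf e(x)=\exp(2\pi i x)$. The torus $(\mathbb R/\mathbb Z)^d$ is identified with $[0,1)^d$. *)

theory Defs
  imports "HOL-Analysis.Analysis"
begin

definition unit_exp :: "real \<Rightarrow> complex" where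
  "unit_exp x = exp (2 * of_real pi * \<i> * of_real x)"

(* Since d is quantified inside the theorem (after the absolute constants), R^d is the set
   of extensional functions on {1..d}; its Lebesgue measure is the completed product of the
   one-dimensional measures, in analogy with lebesgue = completion lborel. *)
definition lebesgue_dim :: "nat \<Rightarrow> (nat \<Rightarrow> real) measure" where
  "lebesgue_dim d = completion (\<Pi>\<^sub>M i\<in>{1..d}. lborel)"

definition weyl_sum :: "(nat \<Rightarrow> complex) \<Rightarrow> nat \<Rightarrow> (nat \<Rightarrow> real) \<Rightarrow> nat \<Rightarrow> complex" where
  "weyl_sum a d x N = (\<Sum>n=1..N. a n * unit_exp (\<Sum>j=1..d. x j * real n ^ j))"

definition sqrt_size_set :: "(nat \<Rightarrow> complex) \<Rightarrow> real \<Rightarrow> real \<Rightarrow> nat \<Rightarrow> (nat \<Rightarrow> real) set" where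
  "sqrt_size_set a c C d =
     {x \<in> {1..d} \<rightarrow>\<^sub>E {0..<1}.
        \<exists>\<^sub>\<infinity>N. c * sqrt (real N) \<le> norm (weyl_sum a d x N) \<and>
             norm (weyl_sum a d x N) \<le> C * sqrt (real N)}"

end

(*
  Write S_N for the Weyl sum and g_N = |S_N|^2 / N. For a nonzero frequency h the equations
  n - m = h_1, n^2 - m^2 = h_2 have at most one solution, and the corresponding quadruple system
  of the fourth moment has o(N^2) solutions. So for every trigonometric polynomial F >= 0, as
  N tends to infinity, the integral of g_N F tends to the integral w of F, and the integral of
  g_N^2 F is at most 2 w + o(1).
  If A is a set on which |S_N| leaves [sqrt N / 2, 2 sqrt N] for all large N, then
  g_N <= 1/4 + 4 (1 - 1_A) + g_N^2 / 4, and integrating against F gives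
  "integral of F over A <= 15/16 w". By Stone-Weierstrass this passes to continuous F, and by
  regularity of the measure to F = 1_A, so |A| <= 15/16 |A| and A is a null set.
*)
theory Submission
  imports Defs "HOL-Probability.Probability_Measure"
begin

subsection \<open>Characters on the unit cube\<close>

text \<open>The moments of the Weyl sums alone would give, for each N, a set of good points of
  measure bounded below. For arbitrary unimodular coefficients no invariance is at hand from which a
  zero-one law could raise this to full measure. The weight F takes the place of such a law: a set
  on which the sums eventually avoid the window would have to be smaller than itself by a fixed
  factor. For a window from \<open>c * sqrt N\<close> to \<open>C * sqrt N\<close> the argument
  gives a factor below 1 exactly when c^2 + 2 / C^2 < 1, the 2 being the number of families of
  trivial solutions in the fourth moment; c = 1/2 and C = 2 satisfy this. The constants are absolute
  because the counting rests on the exponents 1 and 2; further coordinates only add equations. The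
  error terms do depend on the frequencies of F, but F is fixed before N tends to infinity.\<close>

definition character :: "nat \<Rightarrow> (nat \<Rightarrow> int) \<Rightarrow> (nat \<Rightarrow> real) \<Rightarrow> complex" where
  "character d h x = unit_exp (\<Sum>j=1..d. x j * of_int (h j))"

text \<open>The restriction is made by a density so that the sigma-algebra and the space remain
  those of the full product; measurability then carries over in both directions.\<close>

definition cube :: "nat \<Rightarrow> (nat \<Rightarrow> real) measure" where
  "cube d = density (\<Pi>\<^sub>M i\<in>{1..d}. lborel)
     (\<lambda>x. ennreal (indicator ({1..d} \<rightarrow>\<^sub>E {0..<1}) x))"

lemma unit_exp_add: "unit_exp (x + y) = unit_exp x * unit_exp y"
  by (simp add: unit_exp_def ring_distribs exp_add)

lemma unit_exp_sum: "unit_exp (sum f A) = (\<Prod>i\<in>A. unit_exp (f i))"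
proof (induction A rule: infinite_finite_induct)
  case (insert x F)
  then show ?case by (simp add: unit_exp_add)
qed (simp_all add: unit_exp_def)

lemma cnj_unit_exp: "cnj (unit_exp x) = unit_exp (- x)"
  by (simp add: unit_exp_def exp_cnj)

lemma norm_unit_exp [simp]: "norm (unit_exp x) = 1"
  by (simp add: unit_exp_def norm_exp_eq_Re)

lemma continuous_on_unit_exp [continuous_intros]:
  "continuous_on A f \<Longrightarrow> continuous_on A (\<lambda>x. unit_exp (f x))"
  unfolding unit_exp_def by (intro continuous_intros)

lemma measurable_unit_exp [measurable]: "unit_exp \<in> borel_measurable borel"
  by (intro borel_measurable_continuous_onI continuous_intros)

lemma unit_exp_power: "unit_exp x ^ k = unit_exp (x * real k)"
  by (simp add: unit_exp_def flip: exp_of_nat_mult) (simp add: mult_ac)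

lemma integral_unit_exp:
  fixes k :: int
  shows "(\<integral>t. indicator {0..<1} t *\<^sub>R unit_exp (t * of_int k) \<partial>lborel) = (if k = 0 then 1 else 0)"
proof -
  \<comment> \<open>The closed interval, which differs by a null set, is the form in which the
    fundamental theorem of calculus applies.\<close>
  have "(\<integral>t. indicator {0..<1} t *\<^sub>R unit_exp (t * of_int k) \<partial>lborel)
      = (\<integral>t. indicator {0..1} t *\<^sub>R unit_exp (t * of_int k) \<partial>lborel)"
    using AE_lborel_singleton[of "1::real"]
    by (intro integral_cong_AE) (auto simp: indicator_def elim!: eventually_mono)
  also have "\<dots> = (if k = 0 then 1 else 0)"
  proof (cases "k = 0")
    case True
    then show ?thesis by (simp add: unit_exp_def)
  next
    case False
    define w where "w = 2 * of_real pi * \<i> * of_int k"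
    have w: "w \<noteq> 0" using False by (simp add: w_def)
    have e: "unit_exp (t * of_int k) = exp (w * of_real t)" for t
      by (simp add: unit_exp_def w_def mult_ac)
    have "((\<lambda>t. exp (w * of_real t) / w) has_vector_derivative exp (w * of_real t)) (at t within {0..1})" for t
    proof -
      have "((\<lambda>z. exp (w * z) / w) has_field_derivative exp (w * of_real t)) (at (of_real t))"
        using w by (auto intro!: derivative_eq_intros)
      from has_vector_derivative_real_field[OF this] show ?thesis .
    qed
    then have "(\<integral>t. indicator {0..1} t *\<^sub>R exp (w * of_real t) \<partial>lborel)
        = exp (w * of_real 1) / w - exp (w * of_real 0) / w"
      by (intro integral_FTC_Icc) (auto intro!: continuous_intros)
    moreover have "exp w = 1"
      unfolding w_def using exp_integer_2pi[of "of_int k"] by (simp add: mult_ac)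
    ultimately show ?thesis using False by (simp add: e)
  qed
  finally show ?thesis .
qed

lemma measurable_character [measurable]: "character d h \<in> borel_measurable (\<Pi>\<^sub>M i\<in>{1..d}. lborel)"
  unfolding character_def by measurable

lemma sets_cube [simp, measurable_cong]: "sets (cube d) = sets (\<Pi>\<^sub>M i\<in>{1..d}. lborel)"
  by (simp add: cube_def)

lemma space_cube: "space (cube d) = {1..d} \<rightarrow>\<^sub>E UNIV"
  by (simp add: cube_def space_PiM)

lemma unit_cube_in_sets [measurable]:
  "({1..d::nat} \<rightarrow>\<^sub>E {0..<1::real}) \<in> sets (\<Pi>\<^sub>M i\<in>{1..d}. lborel)"
  by (rule sets_PiM_I_finite) auto

lemma emeasure_cube:
  "A \<in> sets (\<Pi>\<^sub>M i\<in>{1..d}. lborel) \<Longrightarrow>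
   emeasure (cube d) A = emeasure (\<Pi>\<^sub>M i\<in>{1..d}. lborel) (({1..d} \<rightarrow>\<^sub>E {0..<1}) \<inter> A)"
proof -
  let ?P = "\<Pi>\<^sub>M i\<in>{1..d}. lborel :: real measure" and ?Q = "{1..d} \<rightarrow>\<^sub>E {0..<1::real}"
  assume A: "A \<in> sets ?P"
  have Q: "(\<lambda>x. ennreal (indicator ?Q x)) \<in> borel_measurable ?P"
    using unit_cube_in_sets by measurable
  have "emeasure (cube d) A = (\<integral>\<^sup>+x. ennreal (indicator ?Q x) * indicator A x \<partial>?P)"
    unfolding cube_def by (rule emeasure_density[OF Q A])
  also have "\<dots> = (\<integral>\<^sup>+x. indicator (?Q \<inter> A) x \<partial>?P)"
    by (auto intro!: nn_integral_cong simp: indicator_def)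
  also have "\<dots> = emeasure ?P (?Q \<inter> A)"
    by (rule nn_integral_indicator) (use A unit_cube_in_sets in auto)
  finally show ?thesis .
qed

lemma prob_space_cube: "prob_space (cube d)"
proof (rule prob_spaceI)
  interpret product_sigma_finite "\<lambda>_::nat. lborel::real measure" ..
  have "emeasure (\<Pi>\<^sub>M i\<in>{1..d}. lborel) ({1..d} \<rightarrow>\<^sub>E {0..<1::real}) = 1"
    by (subst emeasure_PiM) auto
  moreover have "({1..d} \<rightarrow>\<^sub>E {0..<1::real}) \<inter> space (cube d) = {1..d} \<rightarrow>\<^sub>E {0..<1}"
    by (simp add: space_cube PiE_Int)
  moreover have "space (cube d) \<in> sets (\<Pi>\<^sub>M i\<in>{1..d}. lborel)"
    by (metis sets.top sets_cube)
  ultimately show "emeasure (cube d) (space (cube d)) = 1"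
    by (simp only: emeasure_cube)
qed

lemma integral_character:
  "(\<integral>x. character d h x \<partial>cube d) = (if \<forall>j\<in>{1..d}. h j = 0 then 1 else 0)"
proof -
  interpret product_sigma_finite "\<lambda>_::nat. lborel::real measure" ..
  have ind: "indicator ({1..d} \<rightarrow>\<^sub>E {0..<1}) x = (\<Prod>i\<in>{1..d}. indicator {0..<1::real} (x i) :: real)"
    if "x \<in> space (\<Pi>\<^sub>M i\<in>{1..d}. lborel)" for x
    using that by (auto simp: space_PiM indicator_def PiE_iff prod_eq_1_iff)
  have "(\<integral>x. character d h x \<partial>cube d)
      = (\<integral>x. indicator ({1..d} \<rightarrow>\<^sub>E {0..<1}) x *\<^sub>R character d h x \<partial>(\<Pi>\<^sub>M i\<in>{1..d}. lborel))"
    unfolding cube_def by (intro integral_density measurable_character borel_measurable_indicator unit_cube_in_sets) auto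
  also have "\<dots> = (\<integral>x. (\<Prod>i\<in>{1..d}. indicator {0..<1} (x i) *\<^sub>R unit_exp (x i * of_int (h i)))
       \<partial>(\<Pi>\<^sub>M i\<in>{1..d}. lborel))"
    by (intro Bochner_Integration.integral_cong refl)
      (simp add: ind character_def unit_exp_sum scaleR_conv_of_real prod.distrib del: One_nat_def)
  also have "\<dots> = (\<Prod>i\<in>{1..d}. (\<integral>t. indicator {0..<1} t *\<^sub>R unit_exp (t * of_int (h i)) \<partial>lborel))"
    by (intro product_integral_prod) (auto intro!: integrableI_bounded_set_indicator[where B = 1])
  also have "\<dots> = (if \<forall>j\<in>{1..d}. h j = 0 then 1 else 0)"
    by (auto simp: integral_unit_exp)
  finally show ?thesis .
qed

interpretation cube: prob_space "cube d" for d
  by (rule prob_space_cube)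

lemma norm_character [simp]: "norm (character d h x) = 1"
  by (simp add: character_def)

lemma character_mult: "character d g x * character d h x = character d (\<lambda>j. g j + h j) x"
  by (simp add: character_def ring_distribs sum.distrib flip: unit_exp_add)

lemma cnj_character: "cnj (character d h x) = character d (\<lambda>j. - h j) x"
  by (simp add: character_def cnj_unit_exp flip: sum_negf)

lemma measurable_character_cube [measurable]: "character d h \<in> borel_measurable (cube d)"
  by (subst measurable_cong_sets[OF sets_cube refl]) (rule measurable_character)

lemma integrable_character [simp]: "integrable (cube d) (character d h)"
  by (rule cube.integrable_const_bound[where B = 1]) auto

text \<open>By orthogonality only terms of frequency zero survive, each of size at most 1. This
  turns moment bounds into counts of solutions of systems of equations.\<close>

lemma norm_integral_sum_character_le:
  assumes "finite J" "\<And>j. j \<in> J \<Longrightarrow> norm (b j) \<le> 1"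
  shows "norm (\<integral>x. (\<Sum>j\<in>J. b j * character d (h j) x) \<partial>cube d) \<le> card {j\<in>J. \<forall>i\<in>{1..d}. h j i = 0}"
proof -
  have "(\<integral>x. (\<Sum>j\<in>J. b j * character d (h j) x) \<partial>cube d)
      = (\<Sum>j\<in>J. b j * (if \<forall>i\<in>{1..d}. h j i = 0 then 1 else 0))"
    by (simp add: Bochner_Integration.integral_sum integral_character del: mult_cancel_left)
  also have "norm \<dots> \<le> (\<Sum>j\<in>J. if \<forall>i\<in>{1..d}. h j i = 0 then 1 else 0)"
    by (rule sum_norm_le) (use assms in auto)
  also have "\<dots> = card {j\<in>J. \<forall>i\<in>{1..d}. h j i = 0}"
    using assms(1) by (simp add: sum.If_cases Int_def)
  finally show ?thesis .
qed

subsection \<open>Moments of the Weyl sums\<close>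

text \<open>The frequency vector of the term indexed by (n, m) in the product of the Weyl sum with
  its conjugate.\<close>

definition freq :: "nat \<times> nat \<Rightarrow> nat \<Rightarrow> int" where
  "freq p j = int (fst p) ^ j - int (snd p) ^ j"

definition coef :: "(nat \<Rightarrow> complex) \<Rightarrow> nat \<times> nat \<Rightarrow> complex" where
  "coef a p = a (fst p) * cnj (a (snd p))"

lemma weyl_sum_eq_character: "weyl_sum a d x N = (\<Sum>n=1..N. a n * character d (\<lambda>j. int n ^ j) x)"
  by (simp add: weyl_sum_def character_def)

lemma norm_weyl_sum_sq:
  "of_real ((norm (weyl_sum a d x N))\<^sup>2) = (\<Sum>p\<in>{1..N}\<times>{1..N}. coef a p * character d (freq p) x)"
proof -
  have "of_real ((norm (weyl_sum a d x N))\<^sup>2) = weyl_sum a d x N * cnj (weyl_sum a d x N)"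
    by (rule complex_norm_square)
  also have "\<dots> = (\<Sum>n=1..N. \<Sum>m=1..N. coef a (n, m) * (character d (\<lambda>j. int n ^ j) x * character d (\<lambda>j. - (int m ^ j)) x))"
    by (simp add: weyl_sum_eq_character cnj_character sum_product coef_def mult_ac)
  also have "\<dots> = (\<Sum>p\<in>{1..N}\<times>{1..N}. coef a p * character d (freq p) x)"
    unfolding character_mult sum.cartesian_product
        by (intro sum.cong) (auto simp: freq_def[abs_def])
  finally show ?thesis .
qed

lemma norm_weyl_sum_sq_character:
  "of_real ((norm (weyl_sum a d x N))\<^sup>2) * character d h x
     = (\<Sum>p\<in>{1..N}\<times>{1..N}. coef a p * character d (\<lambda>j. freq p j + h j) x)"
  unfolding norm_weyl_sum_sq sum_distrib_right by (simp add: mult.assoc character_mult)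

lemma norm_weyl_sum_4_character:
  "of_real ((norm (weyl_sum a d x N)) ^ 4) * character d h x
     = (\<Sum>q\<in>({1..N}\<times>{1..N})\<times>({1..N}\<times>{1..N}).
          coef a (fst q) * coef a (snd q) * character d (\<lambda>j. freq (fst q) j + freq (snd q) j + h j) x)"
proof -
  have "of_real ((norm (weyl_sum a d x N)) ^ 4) * character d h x
     = of_real ((norm (weyl_sum a d x N))\<^sup>2) * (of_real ((norm (weyl_sum a d x N))\<^sup>2) * character d h x)"
    by (simp add: power_numeral_reduce)
  also have "\<dots> = (\<Sum>p\<in>{1..N}\<times>{1..N}. \<Sum>p'\<in>{1..N}\<times>{1..N}.
        coef a p * coef a p' * (character d (freq p) x * character d (\<lambda>j. freq p' j + h j) x))"
    unfolding norm_weyl_sum_sq_character unfolding norm_weyl_sum_sq sum_product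
        by (simp add: mult_ac)
  also have "\<dots> = (\<Sum>q\<in>({1..N}\<times>{1..N})\<times>({1..N}\<times>{1..N}).
          coef a (fst q) * coef a (snd q) * character d (\<lambda>j. freq (fst q) j + freq (snd q) j + h j) x)"
    unfolding character_mult sum.cartesian_product by (intro sum.cong) (auto simp: add.assoc)
  finally show ?thesis .
qed

section \<open>Counting quadruples with prescribed linear and quadratic sums\<close>

lemma card_abs_le: "real (card {u::int. \<bar>of_int u\<bar> \<le> r}) \<le> 2 * r + 1" "finite {u::int. \<bar>of_int u\<bar>
    \<le> r}"
  if "r \<ge> 0" for r :: real
proof -
  have *: "{u::int. \<bar>of_int u\<bar> \<le> r} = {-\<lfloor>r\<rfloor>..\<lfloor>r\<rfloor>}"
    by (auto simp: abs_le_iff le_floor_iff minus_le_iff[of "\<lfloor>r\<rfloor>"])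
  show "finite {u::int. \<bar>of_int u\<bar> \<le> r}" unfolding * by simp
  have "\<lfloor>r\<rfloor> \<ge> 0" using that by simp
  then show "real (card {u::int. \<bar>of_int u\<bar> \<le> r}) \<le> 2 * r + 1" unfolding * by simp
qed

text \<open>The numbers m and m' are the roots of a monic quadratic whose coefficients are
  determined by their first two power sums. The equations express these through n and n', and twice
  the value of the quadratic at n is the right side. It is linear in n', hence O(N) for fixed
  \<open>h1\<close> and \<open>h2\<close>.\<close>

lemma power_sum_differences:
  fixes n m n' m' h1 h2 :: int
  assumes "n - m + (n' - m') = h1" "n^2 - m^2 + (n'^2 - m'^2) = h2"
  shows "2 * ((n - m) * (n - m')) = h1\<^sup>2 + h2 - 2 * h1 * n'"
  unfolding assms[symmetric] by (simp add: power2_eq_square algebra_simps)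

lemma trivial_power_sums:
  fixes n m n' m' :: int
  assumes "n - m + (n' - m') = 0" "n^2 - m^2 + (n'^2 - m'^2) = 0"
  shows "n = m \<and> n' = m' \<or> n = m' \<and> n' = m"
  using power_sum_differences[OF assms] assms(1) by auto

text \<open>Keeping only the exponents 1 and 2 makes the counts independent of the dimension; larger
  exponents can only cut this set down.\<close>

definition quads :: "nat \<Rightarrow> int \<Rightarrow> int \<Rightarrow> ((nat \<times> nat) \<times> (nat \<times> nat)) set" where
  "quads N h1 h2 = {q \<in> ({1..N}\<times>{1..N})\<times>({1..N}\<times>{1..N}).
     freq (fst q) 1 + freq (snd q) 1 = h1 \<and> freq (fst q) 2 + freq (snd q) 2 = h2}"

lemma finite_quads [simp]: "finite (quads N h1 h2)"
  unfolding quads_def by (rule finite_subset[of _ "({1..N}\<times>{1..N})\<times>({1..N}\<times>{1..N})"]) auto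

text \<open>If n = m, then n' - m' and n'^2 - m'^2 are prescribed and \<open>h1\<close> is nonzero,
  so n' + m' is fixed and only n is free. Otherwise n' and the nonzero n - m yield n - m' through
  \<open>power_sum_differences\<close>, and the linear equation gives the rest.\<close>

lemma quads_determined:
  fixes n m n' m' k l k' l' h1 h2 :: int
  assumes h: "h1 \<noteq> 0 \<or> h2 \<noteq> 0"
    and e1: "n - m + (n' - m') = h1" "n^2 - m^2 + (n'^2 - m'^2) = h2"
    and e2: "k - l + (k' - l') = h1" "k^2 - l^2 + (k'^2 - l'^2) = h2"
    and u: "n - m = k - l" and nk: "if n = m then n = k else n' = k'"
  shows "n = k \<and> m = l \<and> n' = k' \<and> m' = l'"
proof (cases "n = m")
  case True
  then have eq: "n = k" "m = l" using u nk by auto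
  have d: "n' - m' = h1" "k' - l' = h1" using True eq e1 e2 by auto
  have "(n' - m') * (n' + m') = h2" "(k' - l') * (k' + l') = h2"
    using True eq e1 e2 by (auto simp: algebra_simps power2_eq_square)
  then have h1: "h1 * (n' + m') = h2" "h1 * (k' + l') = h2" unfolding d by auto
  then have "h1 \<noteq> 0" using h by auto
  then have "n' + m' = k' + l'" using h1 by (metis mult_cancel_left)
  then show ?thesis using d eq by auto
next
  case False
  then have eq: "n' = k'" using nk by simp
  have "2 * ((n - m) * (n - m')) = 2 * ((n - m) * (k - l'))"
    using power_sum_differences[OF e1] power_sum_differences[OF e2] unfolding eq u by simp
  then have "n - m' = k - l'" using False by simp
  then show ?thesis using e1(1) e2(1) eq u by linarith
qed

lemma card_quads_small_difference:
  fixes r :: real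
  assumes "h1 \<noteq> 0 \<or> h2 \<noteq> 0" "r \<ge> 0"
  shows "real (card {q \<in> quads N h1 h2. \<bar>of_int (freq (fst q) 1)\<bar> \<le> r}) \<le> real N * (2 * r + 1)"
proof -
  let ?X = "{q \<in> quads N h1 h2. \<bar>real_of_int (freq (fst q) 1)\<bar> \<le> r}"
  let ?Y = "{1..N} \<times> {u::int. \<bar>of_int u\<bar> \<le> r}"
  \<comment> \<open>The extra coordinate is the free one of \<open>quads_determined\<close>: it has
    at most N values, and the difference at most 2 r + 1.\<close>
  define f where "f = (\<lambda>((n::nat, m::nat), (n'::nat, m'::nat)).
    (if n = m then n else n', int n - int m))"
  have "inj_on f ?X"
  proof (rule inj_onI)
    fix p q assume p: "p \<in> ?X" and q: "q \<in> ?X" and pq: "f p = f q"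
    obtain n m n' m' k l k' l' where [simp]: "p = ((n, m), (n', m'))" "q = ((k, l), (k', l'))"
      by (metis prod.collapse)
    have "int n = int k \<and> int m = int l \<and> int n' = int k' \<and> int m' = int l'"
    proof (rule quads_determined[OF assms(1)])
      show "int n - int m = int k - int l" using pq by (simp add: f_def)
      then show "if int n = int m then int n = int k else int n' = int k'"
        using pq by (auto simp: f_def split: if_splits)
    qed (use p q in \<open>auto simp: quads_def freq_def\<close>)
    then show "p = q" by simp
  qed
  then have "card ?X \<le> card ?Y"
    by (rule card_inj_on_le) (use card_abs_le(2)[OF assms(2)] in \<open>auto simp: f_def quads_def freq_def\<close>)
  then have "real (card ?X) \<le> real N * real (card {u::int. \<bar>of_int u\<bar> \<le> r})"
    by (simp add: card_cartesian_product flip: of_nat_mult)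
  also have "\<dots> \<le> real N * (2 * r + 1)"
    by (intro mult_left_mono card_abs_le assms) auto
  finally show ?thesis .
qed

text \<open>
  For \<open>u = n - m\<close> and \<open>v = n - m'\<close> the product \<open>2uv\<close> is \<open>O(N)\<close> by \<open>power_sum_differences\<close>, so
  one of the two is \<open>O(\<surd>N)\<close>; exchanging \<open>m\<close> and \<open>m'\<close> reduces to \<open>u\<close> small.
\<close>
lemma card_quads_le:
  assumes "h1 \<noteq> 0 \<or> h2 \<noteq> 0"
  defines "K \<equiv> real_of_int (\<bar>h1\<^sup>2 + h2\<bar> + 2 * \<bar>h1\<bar>)"
  shows "real (card (quads N h1 h2)) \<le> 2 * (real N * (2 * sqrt (K * N) + 1))"
proof -
  define r where "r = sqrt (K * N)"
  have "K \<ge> 0" by (simp add: K_def)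
  then have r: "r \<ge> 0" "r\<^sup>2 = K * N" by (auto simp: r_def)
  let ?X = "{q \<in> quads N h1 h2. \<bar>real_of_int (freq (fst q) 1)\<bar> \<le> r}"
  define swap where "swap = (\<lambda>((n::nat, m::nat), (n'::nat, m'::nat)). ((n, m'), (n', m)))"
  have fin: "finite ?X" by simp
  have "quads N h1 h2 \<subseteq> ?X \<union> swap ` ?X"
  proof
    fix q assume q: "q \<in> quads N h1 h2"
    obtain n m n' m' where [simp]: "q = ((n, m), (n', m'))" by (metis prod.collapse)
    define u where "u = int n - int m"
    define v where "v = int n - int m'"
    have "2 * (u * v) = h1\<^sup>2 + h2 - 2 * h1 * int n'"
      unfolding u_def v_def by (rule power_sum_differences) (use q in \<open>auto simp: quads_def freq_def\<close>)
    then have "\<bar>u * v\<bar> \<le> \<bar>h1\<^sup>2 + h2\<bar> + \<bar>2 * h1 * int n'\<bar>" by linarith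
    also have "\<bar>2 * h1 * int n'\<bar> = 2 * \<bar>h1\<bar> * int n'" by (simp add: abs_mult)
    also have "2 * \<bar>h1\<bar> * int n' \<le> 2 * \<bar>h1\<bar> * int N"
      using q by (intro mult_left_mono) (auto simp: quads_def)
    \<comment> \<open>The existence of \<open>q\<close> forces N to be at least 1.\<close>
    also have "\<bar>h1\<^sup>2 + h2\<bar> \<le> \<bar>h1\<^sup>2 + h2\<bar> * int N"
      using q by (intro mult_le_cancel_left1[THEN iffD2]) (auto simp: quads_def)
    finally have "\<bar>u * v\<bar> \<le> (\<bar>h1\<^sup>2 + h2\<bar> + 2 * \<bar>h1\<bar>) * int N" by (simp add: ring_distribs)
    then have "real_of_int \<bar>u * v\<bar> \<le> real_of_int ((\<bar>h1\<^sup>2 + h2\<bar> + 2 * \<bar>h1\<bar>) * int N)"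
      by (simp only: of_int_le_iff)
    also have "\<dots> = r\<^sup>2" by (simp add: r K_def)
    finally have uv: "\<bar>real_of_int u\<bar> * \<bar>real_of_int v\<bar> \<le> r * r"
      by (simp add: abs_mult power2_eq_square)
    have "\<bar>real_of_int u\<bar> \<le> r \<or> \<bar>real_of_int v\<bar> \<le> r"
    proof (rule ccontr)
      assume "\<not> ?thesis"
      then have "r * r < \<bar>real_of_int u\<bar> * \<bar>real_of_int v\<bar>"
        using r(1) by (intro mult_strict_mono) auto
      then show False using uv by simp
    qed
    then show "q \<in> ?X \<union> swap ` ?X"
    proof
      assume "\<bar>real_of_int u\<bar> \<le> r"
      then show ?thesis using q by (simp add: freq_def u_def)
    next
      assume "\<bar>real_of_int v\<bar> \<le> r"
      then have "((n, m'), (n', m)) \<in> ?X" using q by (auto simp: quads_def freq_def v_def)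
      moreover have "q = swap ((n, m'), (n', m))" by (simp add: swap_def)
      ultimately show ?thesis by blast
    qed
  qed
  then have "card (quads N h1 h2) \<le> card (?X \<union> swap ` ?X)"
    using fin by (intro card_mono) auto
  also have "\<dots> \<le> card ?X + card ?X"
    using card_Un_le[of ?X "swap ` ?X"] card_image_le[OF fin, of swap] by linarith
  finally have "real (card (quads N h1 h2)) \<le> 2 * real (card ?X)" by simp
  also have "\<dots> \<le> 2 * (real N * (2 * r + 1))"
    by (intro mult_left_mono card_quads_small_difference assms r) auto
  finally show ?thesis by (simp add: r_def)
qed

text \<open>The trivial solutions form two families, each parametrised by a pair in the square of
  side N. This is the origin of the constant 2 in the fourth moment.\<close>

lemma card_quads_zero_le: "card (quads N 0 0) \<le> 2 * N\<^sup>2"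
proof -
  let ?I = "{1..N} \<times> {1..N}"
  let ?f = "\<lambda>(n, m). ((n, n), (m, m))" and ?g = "\<lambda>(n, m). ((n, m), (m, n))"
  have "quads N 0 0 \<subseteq> ?f ` ?I \<union> ?g ` ?I"
  proof
    fix q assume q: "q \<in> quads N 0 0"
    obtain n m n' m' where [simp]: "q = ((n, m), (n', m'))" by (metis prod.collapse)
    have "int n = int m \<and> int n' = int m' \<or> int n = int m' \<and> int n' = int m"
      by (rule trivial_power_sums) (use q in \<open>auto simp: quads_def freq_def\<close>)
    then have "q = ?f (n, n') \<or> q = ?g (n, n')" by auto
    moreover have "(n, n') \<in> ?I" using q by (auto simp: quads_def)
    ultimately show "q \<in> ?f ` ?I \<union> ?g ` ?I" by blast
  qed
  then have "card (quads N 0 0) \<le> card (?f ` ?I \<union> ?g ` ?I)" by (intro card_mono) auto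
  also have "\<dots> \<le> card ?I + card ?I"
    using card_Un_le[of "?f ` ?I" "?g ` ?I"] card_image_le[of ?I ?f] card_image_le[of ?I ?g] by simp
  finally show ?thesis by (simp add: power2_eq_square)
qed

section \<open>Moments of the Weyl sums against a single character\<close>

lemma norm_coef:
  assumes "\<forall>n\<ge>1. norm (a n) = 1" "p \<in> {1..N} \<times> {1..N}"
  shows "norm (coef a p) = 1"
  using assms by (auto simp: coef_def norm_mult)

context
  fixes d :: nat and a :: "nat \<Rightarrow> complex"
  assumes d: "d \<ge> 2" and a: "\<forall>n\<ge>1. norm (a n) = 1"
begin

text \<open>The exponent 1 already forces n = m, and unimodularity makes every diagonal term equal
  to 1.\<close>

lemma second_moment: "(\<integral>x. (norm (weyl_sum a d x N))\<^sup>2 \<partial>cube d) = N"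
proof -
  have "complex_of_real (\<integral>x. (norm (weyl_sum a d x N))\<^sup>2 \<partial>cube d)
      = (\<integral>x. (\<Sum>p\<in>{1..N}\<times>{1..N}. coef a p * character d (freq p) x) \<partial>cube d)"
    unfolding norm_weyl_sum_sq[symmetric] by (simp del: of_real_power)
  also have "\<dots> = (\<Sum>p\<in>{1..N}\<times>{1..N}. coef a p * (if \<forall>j\<in>{1..d}. freq p j = 0 then 1 else 0))"
    by (simp add: Bochner_Integration.integral_sum integral_character del: mult_cancel_left)
  also have "\<dots> = (\<Sum>p\<in>{1..N}\<times>{1..N}. if snd p = fst p then 1 else 0)"
  proof (rule sum.cong)
    fix p assume p: "p \<in> {1..N} \<times> {1..N}"
    have "(\<forall>j\<in>{1..d}. freq p j = 0) \<longleftrightarrow> snd p = fst p"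
      using d by (auto simp: freq_def dest!: bspec[of _ _ 1])
    moreover have "coef a p = 1" if "snd p = fst p"
      using that p a by (auto simp: coef_def complex_norm_square[symmetric])
    ultimately show "coef a p * (if \<forall>j\<in>{1..d}. freq p j = 0 then 1 else 0)
        = (if snd p = fst p then 1 else 0)" by auto
  qed simp
  also have "\<dots> = (\<Sum>n=1..N. \<Sum>m=1..N. if m = n then 1 else 0)"
    unfolding sum.cartesian_product by (intro sum.cong) auto
  also have "\<dots> = of_real (real N)" by simp
  finally show ?thesis by (simp only: of_real_eq_iff)
qed

lemma second_moment_character:
  assumes "\<exists>j\<in>{1..d}. h j \<noteq> 0"
  shows "norm (\<integral>x. of_real ((norm (weyl_sum a d x N))\<^sup>2) * character d h x \<partial>cube d) \<le> 1"
proof -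
  let ?X = "{p\<in>{1..N}\<times>{1..N}. \<forall>j\<in>{1..d}. freq p j + h j = 0}"
  have "norm (\<integral>x. of_real ((norm (weyl_sum a d x N))\<^sup>2) * character d h x \<partial>cube d) \<le> card ?X"
    unfolding norm_weyl_sum_sq_character
        by (rule norm_integral_sum_character_le) (auto simp: norm_coef[OF a])
  also have "card ?X \<le> 1"
  proof -
    have "p = q" if p: "p \<in> ?X" and q: "q \<in> ?X" for p q
    proof -
      obtain n m k l where [simp]: "p = (n, m)" "q = (k, l)" by (metis prod.collapse)
      have 1: "int n - int m = int k - int l"
        using p q d by (auto simp: freq_def dest!: bspec[of _ _ 1])
      have "int n ^ 2 - int m ^ 2 = int k ^ 2 - int l ^ 2"
        using p q d by (auto simp: freq_def dest!: bspec[of _ _ 2])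
      then have "(int n - int m) * (int n + int m) = (int k - int l) * (int k + int l)"
        by (simp add: algebra_simps power2_eq_square)
      \<comment> \<open>If n = m, then \<open>freq p\<close> vanishes identically, against the
        nonzero entry of \<open>h\<close>. Hence the common factor n - m can be cancelled.\<close>
      moreover have "n \<noteq> m" using p assms by (auto simp: freq_def)
      ultimately have "int n + int m = int k + int l" unfolding 1[symmetric] by simp
      then show ?thesis using 1 by simp
    qed
    then have "\<forall>p\<in>?X. \<forall>q\<in>?X. p = q" by blast
    moreover have "finite ?X" by auto
    ultimately show ?thesis using card_le_Suc0_iff_eq[of ?X] by (simp only: One_nat_def)
  qed
  finally show ?thesis by simp
qed

lemma fourth_moment_character_le:
  "norm (\<integral>x. of_real ((norm (weyl_sum a d x N)) ^ 4) * character d h x \<partial>cube d) \<le>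
     card {q \<in> quads N (- h 1) (- h 2). \<forall>j\<in>{1..d}. freq (fst q) j + freq (snd q) j + h j = 0}"
proof -
  let ?J = "({1..N}\<times>{1..N})\<times>({1..N}\<times>{1..N})"
  have "norm (\<integral>x. of_real ((norm (weyl_sum a d x N)) ^ 4) * character d h x \<partial>cube d)
     \<le> card {q\<in>?J. \<forall>j\<in>{1..d}. freq (fst q) j + freq (snd q) j + h j = 0}"
    unfolding norm_weyl_sum_4_character
    by (rule norm_integral_sum_character_le) (auto simp: norm_mult norm_coef[OF a])
  also have "{q\<in>?J. \<forall>j\<in>{1..d}. freq (fst q) j + freq (snd q) j + h j = 0}
      = {q \<in> quads N (- h 1) (- h 2). \<forall>j\<in>{1..d}. freq (fst q) j + freq (snd q) j + h j = 0}"
  proof -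
    have "1 \<in> {1..d}" "2 \<in> {1..d}" using d by auto
    then show ?thesis unfolding quads_def by (smt (verit, best) Collect_cong mem_Collect_eq)
  qed
  finally show ?thesis .
qed

lemma fourth_moment: "(\<integral>x. (norm (weyl_sum a d x N)) ^ 4 \<partial>cube d) \<le> 2 * (real N)\<^sup>2"
proof -
  have ch0: "character d (\<lambda>j. 0) x = 1" for x by (simp add: character_def unit_exp_def)
  have "(\<integral>x. (norm (weyl_sum a d x N)) ^ 4 \<partial>cube d)
      = norm (\<integral>x. of_real ((norm (weyl_sum a d x N)) ^ 4) * character d (\<lambda>j. 0) x \<partial>cube d)"
    by (simp add: ch0 del: of_real_power)
  also have "\<dots> \<le> card {q \<in> quads N 0 0. \<forall>j\<in>{1..d}. freq (fst q) j + freq (snd q) j + 0 = 0}"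
    using fourth_moment_character_le[of N "\<lambda>j. 0"] by simp
  also have "card {q \<in> quads N 0 0. \<forall>j\<in>{1..d}. freq (fst q) j + freq (snd q) j + 0 = 0}
      \<le> card (quads N 0 0)"
    by (rule card_mono) auto
  also have "\<dots> \<le> 2 * N\<^sup>2" by (rule card_quads_zero_le)
  finally show ?thesis by simp
qed

text \<open>When \<open>h 1\<close> and \<open>h 2\<close> vanish but a later entry does not, the
  first two equations admit only trivial solutions, and these violate the later equation: the
  integral is zero. Otherwise the count is of order N^(3/2), below the normalisation N^2.\<close>

lemma fourth_moment_character:
  assumes "\<exists>j\<in>{1..d}. h j \<noteq> 0"
  defines "K \<equiv> real_of_int (\<bar>(h 1)\<^sup>2 - h 2\<bar> + 2 * \<bar>h 1\<bar>)"
  shows "norm (\<integral>x. of_real ((norm (weyl_sum a d x N)) ^ 4) * character d h x \<partial>cube d)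
    \<le> 2 * (real N * (2 * sqrt (K * N) + 1))"
proof (cases "h 1 = 0 \<and> h 2 = 0")
  case True
  have "{q \<in> quads N (- h 1) (- h 2). \<forall>j\<in>{1..d}. freq (fst q) j + freq (snd q) j + h j = 0} = {}"
  proof -
    have False if q: "q \<in> quads N 0 0" "\<forall>j\<in>{1..d}. freq (fst q) j + freq (snd q) j + h j = 0" for q
    proof -
      obtain n m n' m' where [simp]: "q = ((n, m), (n', m'))" by (metis prod.collapse)
      have "int n = int m \<and> int n' = int m' \<or> int n = int m' \<and> int n' = int m"
        by (rule trivial_power_sums) (use q in \<open>auto simp: quads_def freq_def\<close>)
      then have "freq (fst q) j + freq (snd q) j = 0" for j by (auto simp: freq_def)
      then show False using q(2) assms(1) by auto
    qed
    moreover have "quads N (- h 1) (- h 2) = quads N 0 0" using True by simp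
    ultimately show ?thesis by blast
  qed
  then have "norm (\<integral>x. of_real ((norm (weyl_sum a d x N)) ^ 4) * character d h x \<partial>cube d) \<le> 0"
    using fourth_moment_character_le[of N h] by (simp only: card.empty of_nat_0)
  also have "0 \<le> 2 * (real N * (2 * sqrt (K * N) + 1))" by (simp add: K_def)
  finally show ?thesis .
next
  case False
  have "norm (\<integral>x. of_real ((norm (weyl_sum a d x N)) ^ 4) * character d h x \<partial>cube d)
      \<le> card {q \<in> quads N (- h 1) (- h 2). \<forall>j\<in>{1..d}. freq (fst q) j + freq (snd q) j + h j = 0}"
    by (rule fourth_moment_character_le)
  also have "card {q \<in> quads N (- h 1) (- h 2). \<forall>j\<in>{1..d}. freq (fst q) j + freq (snd q) j + h j
      = 0}
      \<le> card (quads N (- h 1) (- h 2))"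
    by (rule card_mono) auto
  also have "real (card (quads N (- h 1) (- h 2))) \<le> 2 * (real N * (2 * sqrt (K * N) + 1))"
    using card_quads_le[of "- h 1" "- h 2" N] False by (simp add: K_def)
  finally show ?thesis by simp
qed

end

subsection \<open>Moments weighted by trigonometric polynomials\<close>

text \<open>The induction principle is the point: a limit statement additive in the weight has to be
  checked only for multiples of characters.\<close>

inductive trig_poly :: "nat \<Rightarrow> ((nat \<Rightarrow> real) \<Rightarrow> complex) \<Rightarrow> bool" for d where
  monom: "trig_poly d (\<lambda>x. c * character d h x)"
| add: "trig_poly d f \<Longrightarrow> trig_poly d g \<Longrightarrow> trig_poly d (\<lambda>x. f x + g x)"

lemma trig_poly_const: "trig_poly d (\<lambda>x. c)"
proof -
  have "trig_poly d (\<lambda>x. c * character d (\<lambda>_. 0) x)" by (rule trig_poly.monom)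
  then show ?thesis by (simp add: character_def unit_exp_def)
qed

text \<open>Closure under products supplies the ring required by Stone-Weierstrass.\<close>

lemma trig_poly_mult:
  assumes "trig_poly d f" "trig_poly d g"
  shows "trig_poly d (\<lambda>x. f x * g x)"
  using assms(1)
proof induction
  case (monom c h)
  show ?case using assms(2)
  proof induction
    case (monom c' h')
    have "trig_poly d (\<lambda>x. (c * c') * character d (\<lambda>j. h j + h' j) x)" by (rule trig_poly.monom)
    then show ?case by (simp add: character_mult[symmetric] mult_ac)
  next
    case (add f g)
    then show ?case using trig_poly.add by (simp add: ring_distribs)
  qed
next
  case (add f g)
  then show ?case using trig_poly.add by (simp add: ring_distribs)
qed

lemma trig_poly_measurable: "trig_poly d f \<Longrightarrow> f \<in> borel_measurable (cube d)"
  by (induction rule: trig_poly.induct) (intro borel_measurable_times borel_measurable_add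
      borel_measurable_const measurable_character_cube; assumption)+

lemma trig_poly_bounded: "trig_poly d f \<Longrightarrow> \<exists>B. \<forall>x. norm (f x) \<le> B"
proof (induction rule: trig_poly.induct)
  case (monom c h)
  then show ?case by (intro exI[of _ "norm c"]) (simp add: norm_mult)
next
  case (add f g)
  then show ?case by (meson add_mono norm_triangle_le)
qed

lemma integrable_trig_poly_mult:
  fixes g :: "_ \<Rightarrow> complex"
  assumes f: "trig_poly d f" and g: "g \<in> borel_measurable (cube d)" "\<And>x. norm (g x) \<le> C"
  shows "integrable (cube d) (\<lambda>x. g x * f x)"
proof -
  obtain B where B: "\<And>x. norm (f x) \<le> B" using trig_poly_bounded[OF f] by blast
  have "norm (g x * f x) \<le> C * B" for x
    unfolding norm_mult by (intro mult_mono g B) (use g(2)[of x] norm_ge_zero[of "g x"] in linarith, simp)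
  then show ?thesis
    by (intro cube.integrable_const_bound[where B
        = "C * B"] borel_measurable_times g trig_poly_measurable f) auto
qed

lemma integrable_trig_poly: "trig_poly d f \<Longrightarrow> integrable (cube d) f"
  using integrable_trig_poly_mult[of d f "\<lambda>_. 1" 1] by simp

lemma measurable_weyl_sum [measurable]: "(\<lambda>x. weyl_sum a d x N) \<in> borel_measurable (cube d)"
  unfolding weyl_sum_eq_character
      by (intro borel_measurable_sum borel_measurable_times borel_measurable_const measurable_character_cube)

section \<open>Normalised squares tested against trigonometric polynomials\<close>

definition mean_sq :: "(nat \<Rightarrow> complex) \<Rightarrow> nat \<Rightarrow> nat \<Rightarrow> (nat \<Rightarrow> real) \<Rightarrow> real" where
  "mean_sq a d N x = (norm (weyl_sum a d x N))\<^sup>2 / real N"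

lemma measurable_mean_sq [measurable]: "mean_sq a d N \<in> borel_measurable (cube d)"
  unfolding mean_sq_def[abs_def] by measurable

lemma mean_sq_nonneg: "0 \<le> mean_sq a d N x"
  by (simp add: mean_sq_def)

context
  fixes d :: nat and a :: "nat \<Rightarrow> complex"
  assumes d: "d \<ge> 2" and a: "\<forall>n\<ge>1. norm (a n) = 1"
begin

lemma mean_sq_le: "mean_sq a d N x \<le> N"
proof -
  have "norm (weyl_sum a d x N) \<le> (\<Sum>n=1..N. 1)"
    unfolding weyl_sum_eq_character by (rule sum_norm_le) (use a in \<open>auto simp: norm_mult\<close>)
  then have "(norm (weyl_sum a d x N))\<^sup>2 \<le> (real N)\<^sup>2" by (intro power_mono) auto
  then show ?thesis by (auto simp: mean_sq_def divide_simps power2_eq_square)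
qed

lemma integrable_mean_sq_power_mult:
  assumes "trig_poly d f"
  shows "integrable (cube d) (\<lambda>x. of_real (mean_sq a d N x ^ k) * f x)"
  by (rule integrable_trig_poly_mult[OF assms, where C = "real N ^ k"])
    (auto simp: norm_power abs_of_nonneg mean_sq_nonneg intro!: power_mono mean_sq_le)

lemma tendsto_integral_mean_sq:
  assumes "trig_poly d f"
  shows "(\<lambda>N. \<integral>x. of_real (mean_sq a d N x) * f x \<partial>cube d) \<longlonglongrightarrow> (\<integral>x. f x \<partial>cube d)"
  using assms
proof induction
  case (monom c h)
  let ?I = "\<lambda>N. \<integral>x. of_real ((norm (weyl_sum a d x N))\<^sup>2) * character d h x \<partial>cube d"
  have eq: "(\<integral>x. of_real (mean_sq a d N x) * (c * character d h x) \<partial>cube d) = c * (?I N / N)" for N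
  proof -
    have "of_real (mean_sq a d N x) * (c * character d h x)
        = c / N * (of_real ((norm (weyl_sum a d x N))\<^sup>2) * character d h x)" for x
      by (simp add: mean_sq_def)
    then show ?thesis by (simp only: integral_mult_right_zero) simp
  qed
  have "(\<lambda>N. ?I N / N) \<longlonglongrightarrow> (\<integral>x. character d h x \<partial>cube d)"
  proof (cases "\<forall>j\<in>{1..d}. h j = 0")
    case True
    then have "character d h x = 1" for x by (simp add: character_def unit_exp_def)
    then have "?I N / N = 1" if "N \<ge> 1" for N
      using second_moment[OF d a, of N] that by (simp del: of_real_power)
    then have "(\<lambda>N. ?I N / N) \<longlonglongrightarrow> 1"
      by (intro tendsto_eventually eventually_sequentiallyI[of 1])
    then show ?thesis using True by (simp add: integral_character)
  next
    case False
    have "(\<lambda>N. ?I N / N) \<longlonglongrightarrow> 0"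
    proof (rule Lim_null_comparison)
      show "\<forall>\<^sub>F N in sequentially. norm (?I N / N) \<le> 1 / real N"
        using second_moment_character[OF d a] False
        by (intro always_eventually) (auto simp: norm_divide intro!: divide_right_mono)
    qed (rule lim_1_over_n)
    then show ?thesis using False by (auto simp: integral_character)
  qed
  then show ?case unfolding eq integral_mult_right_zero by (rule tendsto_mult_left)
next
  case (add f g)
  have "(\<integral>x. of_real (mean_sq a d N x) * (f x + g x) \<partial>cube d)
      = (\<integral>x. of_real (mean_sq a d N x) * f x \<partial>cube d) + (\<integral>x. of_real (mean_sq a d N x) * g x \<partial>cube d)" for N
    using integrable_mean_sq_power_mult[of f N 1] integrable_mean_sq_power_mult[of g N 1] add.hyps
    by (simp add: ring_distribs)
  then show ?case using add by (simp add: integrable_trig_poly tendsto_add)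
qed

text \<open>Stated as a difference because this is additive in \<open>f\<close> and so passes
  through the induction. The upper bound 2 for the mean of the square enters only later, for
  nonnegative weights.\<close>

lemma tendsto_integral_mean_sq_sq:
  assumes "trig_poly d f"
  shows "(\<lambda>N. (\<integral>x. of_real ((mean_sq a d N x)\<^sup>2) * f x \<partial>cube d)
      - of_real (\<integral>x. (mean_sq a d N x)\<^sup>2 \<partial>cube d) * (\<integral>x. f x \<partial>cube d)) \<longlonglongrightarrow> 0"
  using assms
proof induction
  case (monom c h)
  let ?I = "\<lambda>N. \<integral>x. of_real ((norm (weyl_sum a d x N)) ^ 4) * character d h x \<partial>cube d"
  let ?J = "\<lambda>N. of_real (\<integral>x. (mean_sq a d N x)\<^sup>2 \<partial>cube d) :: complex"
  have sq: "(mean_sq a d N x)\<^sup>2 = norm (weyl_sum a d x N) ^ 4 / (real N)\<^sup>2" for N x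
    by (simp add: mean_sq_def power_divide)
  have eq: "(\<integral>x. of_real ((mean_sq a d N x)\<^sup>2) * (c * character d h x) \<partial>cube d)
      = c * (?I N / (of_nat N)\<^sup>2)" for N
  proof -
    have "of_real ((mean_sq a d N x)\<^sup>2) * (c * character d h x)
        = c / (of_nat N)\<^sup>2 * (of_real ((norm (weyl_sum a d x N)) ^ 4) * character d h x)" for x
      by (simp add: sq)
    then show ?thesis by (simp only: integral_mult_right_zero) simp
  qed
  have "(\<lambda>N. ?I N / (of_nat N)\<^sup>2 - ?J N * (\<integral>x. character d h x \<partial>cube d)) \<longlonglongrightarrow> 0"
  proof (cases "\<forall>j\<in>{1..d}. h j = 0")
    case True
    then have "character d h x = 1" for x by (simp add: character_def unit_exp_def)
    then have "?I N = of_real (\<integral>x. norm (weyl_sum a d x N) ^ 4 \<partial>cube d)"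
      and "(\<integral>x. character d h x \<partial>cube d) = 1" for N
      by (simp_all add: cube.prob_space del: of_real_power)
    then show ?thesis unfolding sq by simp
  next
    case False
    define K where "K = real_of_int (\<bar>(h 1)\<^sup>2 - h 2\<bar> + 2 * \<bar>h 1\<bar>)"
    have I: "norm (?I N) \<le> 2 * (real N * (2 * sqrt (K * N) + 1))" for N
      unfolding K_def by (rule fourth_moment_character[OF d a]) (use False in blast)
    have "(\<lambda>N. ?I N / (of_nat N)\<^sup>2) \<longlonglongrightarrow> 0"
    proof (rule Lim_null_comparison)
      show "\<forall>\<^sub>F N in sequentially. norm (?I N / (of_nat N)\<^sup>2)
          \<le> 4 * sqrt K * sqrt (1 / real N) + 2 * (1 / real N)"
      proof (rule eventually_mono[OF eventually_gt_at_top[of 0]])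
        fix N :: nat assume N: "0 < N"
        have "norm (?I N / (of_nat N)\<^sup>2) \<le> 2 * (real N * (2 * sqrt (K * N) + 1)) / (real N)\<^sup>2"
          using I[of N] by (auto simp: norm_divide norm_power intro!: divide_right_mono)
        also have "\<dots> = 4 * sqrt K * sqrt (1 / real N) + 2 * (1 / real N)"
          using N by (simp add: real_sqrt_mult real_sqrt_divide divide_simps power2_eq_square)
            (simp add: ring_distribs mult.assoc)
        finally show "norm (?I N / (of_nat N)\<^sup>2)
            \<le> 4 * sqrt K * sqrt (1 / real N) + 2 * (1 / real N)" .
      qed
      have "(\<lambda>N. 4 * sqrt K * sqrt (1 / real N) + 2 * (1 / real N)) \<longlonglongrightarrow> 4 * sqrt K * sqrt 0 + 2 * 0"
        by (intro tendsto_intros lim_1_over_n)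
      then show "(\<lambda>N. 4 * sqrt K * sqrt (1 / real N) + 2 * (1 / real N)) \<longlonglongrightarrow> 0" by simp
    qed
    then show ?thesis using False by (auto simp: integral_character)
  qed
  then have "(\<lambda>N. c * (?I N / (of_nat N)\<^sup>2 - ?J N * (\<integral>x. character d h x \<partial>cube d))) \<longlonglongrightarrow> c * 0"
    by (rule tendsto_mult_left)
  then show ?case unfolding eq by (simp add: algebra_simps)
next
  case (add f g)
  have "(\<integral>x. of_real ((mean_sq a d N x)\<^sup>2) * (f x + g x) \<partial>cube d)
      = (\<integral>x. of_real ((mean_sq a d N x)\<^sup>2) * f x \<partial>cube d) + (\<integral>x. of_real ((mean_sq a d N x)\<^sup>2) * g x \<partial>cube d)" for N
    using integrable_mean_sq_power_mult[of f N 2] integrable_mean_sq_power_mult[of g N 2] add.hyps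
    by (simp add: ring_distribs)
  then show ?case
    using tendsto_add[OF add.IH] add.hyps by (simp add: integrable_trig_poly algebra_simps)
qed

lemma integral_mean_sq_sq_le: "(\<integral>x. (mean_sq a d N x)\<^sup>2 \<partial>cube d) \<le> 2"
proof (cases "N = 0")
  case False
  have "(\<integral>x. (mean_sq a d N x)\<^sup>2 \<partial>cube d) = (\<integral>x. norm (weyl_sum a d x N) ^ 4 \<partial>cube d) / (real N)\<^sup>2"
    by (simp add: mean_sq_def power_divide)
  also have "\<dots> \<le> 2" using fourth_moment[OF d a, of N] False by (simp add: divide_simps)
  finally show ?thesis .
qed (simp add: mean_sq_def)

lemma integral_on_avoiding_set_le:
  fixes F :: "(nat \<Rightarrow> real) \<Rightarrow> real"
  assumes F: "trig_poly d (\<lambda>x. of_real (F x))" and F0: "\<And>x. F x \<ge> 0"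
    and A: "A \<in> sets (cube d)"
    and avoid: "\<And>x N. x \<in> A \<Longrightarrow> N \<ge> N0 \<Longrightarrow>
      \<not> (1 / 2 * sqrt N \<le> norm (weyl_sum a d x N) \<and> norm (weyl_sum a d x N) \<le> 2 * sqrt N)"
  shows "(\<integral>x. indicator A x * F x \<partial>cube d) \<le> 15 / 16 * (\<integral>x. F x \<partial>cube d)"
proof -
  define w where "w = (\<integral>x. F x \<partial>cube d)"
  define v where "v = (\<integral>x. indicator A x * F x \<partial>cube d)"
  define g where "g = mean_sq a d"
  define M where "M N = (\<integral>x. (g N x)\<^sup>2 \<partial>cube d)" for N
  have int: "integrable (cube d) (\<lambda>x. g N x ^ k * F x)" for N k
  proof -
    have "integrable (cube d) (\<lambda>x. complex_of_real (g N x ^ k * F x))"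
      using integrable_mean_sq_power_mult[OF F, of N k] by (simp add: g_def)
    then show ?thesis by (simp only: complex_of_real_integrable_eq)
  qed
  have intF: "integrable (cube d) F" using int[of 0 0] by simp
  have intA: "integrable (cube d) (\<lambda>x. indicator A x * F x)"
    using integrable_mult_indicator[OF A intF] by simp
  have lim1: "(\<lambda>N. \<integral>x. g N x * F x \<partial>cube d) \<longlonglongrightarrow> w"
    using tendsto_integral_mean_sq[OF F] unfolding w_def g_def
    by (simp add: tendsto_of_real_iff flip: of_real_mult)
  have lim2: "(\<lambda>N. (\<integral>x. (g N x)\<^sup>2 * F x \<partial>cube d) - M N * w) \<longlonglongrightarrow> 0"
  proof -
    have "(\<lambda>N. complex_of_real ((\<integral>x. (g N x)\<^sup>2 * F x \<partial>cube d) - M N * w)) \<longlonglongrightarrow> of_real 0"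
      using tendsto_integral_mean_sq_sq[OF F] unfolding w_def g_def M_def
      by (simp flip: of_real_mult of_real_power of_real_diff)
    then show ?thesis by (simp only: tendsto_of_real_iff)
  qed
  have pointwise: "g N x * F x
      \<le> 1 / 4 * F x + 4 * (F x - indicator A x * F x) + 1 / 4 * ((g N x)\<^sup>2 * F x)"
    if N: "N \<ge> N0" "N \<ge> 1" for N x
  proof -
    \<comment> \<open>The levels 1/4 and 4 are the squares of the window constants 1/2 and 2.
      Between them \<open>x\<close> lies outside \<open>A\<close> and the middle term is 4; below,
      the constant 1/4 suffices; above, g <= g^2 / 4.\<close>
    have "g N x \<le> 1 / 4 + 4 * (1 - indicator A x) + 1 / 4 * (g N x)\<^sup>2"
    proof (cases "1 / 4 \<le> g N x \<and> g N x \<le> 4")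
      case True
      have "x \<notin> A"
      proof
        assume "x \<in> A"
        let ?s = "norm (weyl_sum a d x N)"
        have "(1 / 2 * sqrt N)\<^sup>2 \<le> ?s\<^sup>2" "?s\<^sup>2 \<le> (2 * sqrt N)\<^sup>2"
          using True N by (auto simp: g_def mean_sq_def power_mult_distrib power_divide divide_simps)
        then have "1 / 2 * sqrt N \<le> ?s" "?s \<le> 2 * sqrt N"
          using power2_le_imp_le[of "1 / 2 * sqrt N" ?s] power2_le_imp_le[of ?s "2 * sqrt N"] by auto
        then show False using avoid[OF \<open>x \<in> A\<close> N(1)] by blast
      qed
      then show ?thesis using True by (simp add: add.commute add_increasing2)
    next
      case False
      have "g N x \<ge> 0" by (simp add: g_def mean_sq_nonneg)
      with False have "g N x \<le> 1 / 4 + 1 / 4 * (g N x)\<^sup>2"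
      proof (cases "g N x < 1 / 4")
        case False
        with \<open>\<not> (1 / 4 \<le> g N x \<and> g N x \<le> 4)\<close> have "g N x * 4 \<le> g N x * g N x"
          by (intro mult_left_mono) auto
        then show ?thesis by (simp add: power2_eq_square)
      qed (simp add: add_increasing2)
      moreover have "0 \<le> 4 * (1 - indicator A x :: real)" by (simp add: indicator_def)
      ultimately show ?thesis by linarith
    qed
    from mult_right_mono[OF this F0[of x]] show ?thesis by (simp add: algebra_simps)
  qed
  have ineq: "(\<integral>x. g N x * F x \<partial>cube d) \<le> 1 / 4 * w + 4 * (w - v)
      + 1 / 4 * (2 * w + ((\<integral>x. (g N x)\<^sup>2 * F x \<partial>cube d) - M N * w))" if N: "N \<ge> N0" "N \<ge> 1" for N
  proof -
    have "(\<integral>x. g N x * F x \<partial>cube d)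
        \<le> (\<integral>x. 1 / 4 * F x + 4 * (F x - indicator A x * F x) + 1 / 4 * ((g N x)\<^sup>2 * F x) \<partial>cube d)"
      using int[of N 1] by (intro integral_mono Bochner_Integration.integrable_add integrable_mult_right
          Bochner_Integration.integrable_diff intF intA int pointwise N) auto
    also have "\<dots> = 1 / 4 * w + 4 * (w - v) + 1 / 4 * (\<integral>x. (g N x)\<^sup>2 * F x \<partial>cube d)"
      using intF intA int[of N 2] by (simp add: w_def v_def)
    \<comment> \<open>Nonnegativity of \<open>F\<close> enters again, through w >= 0, to multiply
      the fourth-moment bound by \<open>w\<close>.\<close>
    also have "M N * w \<le> 2 * w"
      using integral_mean_sq_sq_le[of N] F0
      by (intro mult_right_mono) (auto simp: M_def g_def w_def)
    ultimately show ?thesis by (simp add: field_simps)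
  qed
  \<comment> \<open>In the limit the error disappears and the inequality amounts to 4 v <= (15/4)
    w.\<close>
  have "w \<le> 1 / 4 * w + 4 * (w - v) + 1 / 4 * (2 * w + 0)"
  proof (rule LIMSEQ_le[OF lim1])
    show "(\<lambda>N. 1 / 4 * w + 4 * (w - v)
      + 1 / 4 * (2 * w + ((\<integral>x. (g N x)\<^sup>2 * F x \<partial>cube d) - M N * w))) \<longlonglongrightarrow>
      1 / 4 * w + 4 * (w - v) + 1 / 4 * (2 * w + 0)"
      by (intro tendsto_intros lim2)
    show "\<exists>n0. \<forall>N\<ge>n0. (\<integral>x. g N x * F x \<partial>cube d) \<le> 1 / 4 * w + 4 * (w - v)
      + 1 / 4 * (2 * w + ((\<integral>x. (g N x)\<^sup>2 * F x \<partial>cube d) - M N * w))"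
      using ineq by (intro exI[of _ "max N0 1"]) auto
  qed
  then show ?thesis unfolding w_def v_def by (simp add: field_simps)
qed

end

subsection \<open>From trigonometric polynomials to measurable sets\<close>

text \<open>All natural numbers serve as coordinates, so that points live in a type carrying the
  product topology; \<open>torus_map\<close> fills the positions outside {1..d} with 1.\<close>

definition torus :: "(nat \<Rightarrow> complex) set" where
  "torus = {z. \<forall>i. norm (z i) = 1}"

definition torus_map :: "nat \<Rightarrow> (nat \<Rightarrow> real) \<Rightarrow> nat \<Rightarrow> complex" where
  "torus_map d x i = (if i \<in> {1..d} then unit_exp (x i) else 1)"

lemma torus_map_in_torus: "torus_map d x \<in> torus"
  by (simp add: torus_def torus_map_def)

lemma compact_torus: "compact torus"
proof -
  have "compactin (product_topology (\<lambda>i. euclidean) UNIV) (PiE UNIV (\<lambda>i::nat. sphere 0 1 :: complex set))"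
    unfolding compactin_PiE by (simp add: compactin_euclidean_iff)
  moreover have "PiE UNIV (\<lambda>i::nat. sphere 0 1 :: complex set) = torus"
    by (auto simp: torus_def)
  ultimately show ?thesis
    by (simp add: euclidean_product_topology compactin_euclidean_iff)
qed

lemma measurable_torus_map [measurable]: "torus_map d \<in> measurable (cube d) borel"
proof -
  have "torus_map d \<in> measurable (cube d) (\<Pi>\<^sub>M i\<in>UNIV. borel)"
  proof (rule measurable_abs_UNIV)
    fix i
    show "(\<lambda>x. torus_map d x i) \<in> borel_measurable (cube d)"
    proof (cases "i \<in> {1..d}")
      case True
      then have "(\<lambda>x. unit_exp (x i)) \<in> borel_measurable (\<Pi>\<^sub>M i\<in>{1..d}. lborel)" by measurable
      then show ?thesis using True unfolding torus_map_def
        by (simp add: measurable_cong_sets[OF sets_cube refl] del: One_nat_def)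
    next
      case False
      then have "(\<lambda>x. torus_map d x i) = (\<lambda>x. 1)" by (auto simp: torus_map_def)
      then show ?thesis by simp
    qed
  qed
  then show ?thesis by (simp add: measurable_cong_sets[OF refl sets_PiM_equal_borel])
qed

text \<open>Stone-Weierstrass is applied to real functions, hence the split into real and imaginary
  parts, which are linear combinations of a character and its conjugate.\<close>

lemma trig_poly_coordinate:
  "trig_poly d (\<lambda>x. of_real (Re (torus_map d x i)))" "trig_poly d (\<lambda>x. of_real (Im (torus_map d x i)))"
proof -
  define u where "u x = torus_map d x i" for x
  have "trig_poly d (\<lambda>x. c * u x + c' * cnj (u x))" for c c'
  proof (cases "i \<in> {1..d}")
    case True
    let ?h = "\<lambda>j. if j = i then 1 else 0 :: int"
    have "(\<Sum>j=1..d. x j * of_int (?h j)) = x i" for x :: "nat \<Rightarrow> real"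
    proof -
      have "(\<Sum>j=1..d. x j * of_int (?h j)) = (\<Sum>j=1..d. if i = j then x j else 0)"
        by (intro sum.cong) auto
      then show ?thesis using True by simp
    qed
    then have u: "u x = character d ?h x" for x
      using True by (simp add: u_def torus_map_def character_def)
    show ?thesis unfolding u cnj_character by (intro trig_poly.intros)
  next
    case False
    then have u: "u x = 1" for x by (auto simp: u_def torus_map_def)
    show ?thesis unfolding u by (rule trig_poly_const)
  qed
  note lin = this
  have "of_real (Re z) = 1 / 2 * z + 1 / 2 * cnj z" "of_real (Im z)
      = - \<i> / 2 * z + \<i> / 2 * cnj z" for z
    by (simp_all add: complex_eq_iff)
  then   show "trig_poly d (\<lambda>x. of_real (Re (torus_map d x i)))" "trig_poly d (\<lambda>x. of_real (Im (torus_map d x i)))"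
    unfolding u_def[symmetric] using lin[of "1 / 2" "1 / 2"] lin[of "- \<i> / 2" "\<i> / 2"]
        by (simp_all only:)
qed

lemma trig_poly_approximation:
  fixes f :: "(nat \<Rightarrow> complex) \<Rightarrow> real"
  assumes f: "continuous_on torus f" and e: "e > 0"
  obtains g where "trig_poly d (\<lambda>x. of_real (g x))" "\<And>x. \<bar>f (torus_map d x) - g x\<bar> < e"
proof -
  \<comment> \<open>Points must be separated on the whole of \<open>torus\<close>, also by
    coordinates outside {1..d}. Those pull back along \<open>torus_map\<close> to constants, which
    are trigonometric polynomials as well.\<close>
  let ?R = "{g. continuous_on torus g \<and> trig_poly d (\<lambda>x. of_real (g (torus_map d x)))}"
  interpret function_ring_on ?R torus
  proof (rule function_ring_on.intro, goal_cases)
    case (6 x y)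
    then have xy: "x \<in> torus" "y \<in> torus" "x \<noteq> y" by auto
    then obtain i where "x i \<noteq> y i" by blast
    then have neq: "Re (x i) \<noteq> Re (y i) \<or> Im (x i) \<noteq> Im (y i)" by (simp add: complex_eq_iff)
    have "continuous_on torus (\<lambda>z. z i)"
      by (rule continuous_on_subset[OF continuous_on_product_coordinates]) simp
    then have R: "(\<lambda>z. Re (z i)) \<in> ?R" "(\<lambda>z. Im (z i)) \<in> ?R"
      using trig_poly_coordinate by (simp_all add: continuous_on_Re continuous_on_Im)
    from neq show "\<exists>f\<in>?R. f x \<noteq> f y"
      by (elim disjE) (rule bexI[OF _ R(1)], assumption, rule bexI[OF _ R(2)], assumption)
  next
    case (3 f g)
    then show ?case
      using trig_poly.add[of d "\<lambda>x. of_real (f (torus_map d x))" "\<lambda>x. of_real (g (torus_map d x))"]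
      by (simp add: continuous_on_add)
  next
    case (4 f g)
    then show ?case
      using trig_poly_mult[of d "\<lambda>x. of_real (f (torus_map d x))" "\<lambda>x. of_real (g (torus_map d x))"]
      by (simp add: continuous_on_mult)
  qed (simp_all add: compact_torus trig_poly_const)
  obtain g where "g \<in> ?R" "\<forall>x\<in>torus. \<bar>f x - g x\<bar> < e" using Stone_Weierstrass_basic[OF f e] by blast
  then show ?thesis using that[of "\<lambda>x. g (torus_map d x)"] torus_map_in_torus by auto
qed

text \<open>
  The Weyl sum is a polynomial in \<open>z\<^sub>j = unit_exp (x\<^sub>j)\<close>. This lets the sets below be Borel sets of
  points \<open>z\<close>, to which both Stone--Weierstrass on the compact torus and regularity apply.
\<close>
definition weyl_poly :: "(nat \<Rightarrow> complex) \<Rightarrow> nat \<Rightarrow> nat \<Rightarrow> (nat \<Rightarrow> complex) \<Rightarrow> complex" where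
  "weyl_poly a d N z = (\<Sum>n=1..N. a n * (\<Prod>j=1..d. z j ^ (n ^ j)))"

lemma weyl_poly_torus_map: "weyl_poly a d N (torus_map d x) = weyl_sum a d x N"
  unfolding weyl_poly_def weyl_sum_def unit_exp_sum
  by (intro sum.cong refl arg_cong2[where f
      = "(*)"] prod.cong) (simp add: torus_map_def unit_exp_power)

lemma measurable_weyl_poly [measurable]: "weyl_poly a d N \<in> borel_measurable borel"
  unfolding weyl_poly_def[abs_def]
  by (intro borel_measurable_continuous_onI continuous_intros continuous_on_product_coordinates)

section \<open>Eventual avoidance of the window is a null event\<close>

context
  fixes d :: nat and a :: "nat \<Rightarrow> complex"
  assumes d: "d \<ge> 2" and a: "\<forall>n\<ge>1. norm (a n) = 1"
begin

definition avoiding :: "nat \<Rightarrow> (nat \<Rightarrow> complex) set" where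
  "avoiding N0 = {z. \<forall>N\<ge>N0.
      \<not> (1 / 2 * sqrt N \<le> norm (weyl_poly a d N z) \<and> norm (weyl_poly a d N z) \<le> 2 * sqrt N)}"

lemma avoiding_borel [measurable]: "avoiding N0 \<in> sets borel"
  unfolding avoiding_def by measurable

text \<open>Regularity and Stone-Weierstrass are combined in one estimate. K and U enclose B with
  measures within e of p, a Urysohn function f lies between their indicators, and a trigonometric
  polynomial F lies between f and f + 2 e. Bounding the integral of F over the avoiding set from
  both sides gives p - e < 15/16 (p + 3 e).\<close>

lemma null_avoiding: "measure (distr (cube d) borel (torus_map d)) (avoiding N0) = 0"
proof (rule ccontr)
  define B where "B = avoiding N0"
  define \<nu> where "\<nu> = distr (cube d) borel (torus_map d)"
  interpret \<nu>: prob_space \<nu> unfolding \<nu>_def by (rule cube.prob_space_distr) measurable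
  define p where "p = measure \<nu> B"
  assume "\<not> ?thesis"
  then have p: "p > 0" by (simp add: p_def B_def \<nu>_def zero_less_measure_iff)
  \<comment> \<open>The final inequality fails as soon as 61 e <= p.\<close>
  define e where "e = p / 128"
  have e: "e > 0" using p by (simp add: e_def)
  have B: "B \<in> sets borel" and sets_\<nu>: "sets \<nu> = sets borel" by (auto simp: B_def \<nu>_def)
  have fin: "emeasure \<nu> (space \<nu>) \<noteq> \<infinity>" by (simp add: \<nu>.emeasure_space_1)
  have "ennreal (p - e) < emeasure \<nu> B"
    using p e by (simp add: \<nu>.emeasure_eq_measure p_def[symmetric] ennreal_less_iff e_def)
  then obtain K where K: "K \<subseteq> B" "compact K" "ennreal (p - e) < emeasure \<nu> K"
    unfolding inner_regular[OF sets_\<nu> fin B] less_SUP_iff by blast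
  have "emeasure \<nu> B < ennreal (p + e)"
    using p e by (simp add: \<nu>.emeasure_eq_measure p_def[symmetric] ennreal_less_iff)
  then obtain U where U: "B \<subseteq> U" "open U" "emeasure \<nu> U < ennreal (p + e)"
    unfolding outer_regular[OF sets_\<nu> fin B] INF_less_iff by blast
  have Kp: "p - e < measure \<nu> K"
    using K(3) p by (simp add: \<nu>.emeasure_eq_measure ennreal_less_iff e_def)
  have Up: "measure \<nu> U < p + e"
    using U(3) by (simp add: \<nu>.emeasure_eq_measure ennreal_less_iff)
  have Kb: "K \<in> sets borel" and Ub: "U \<in> sets borel" using K U by (auto simp: compact_imp_closed)
  obtain f :: "(nat \<Rightarrow> complex) \<Rightarrow> real" where f: "continuous_on UNIV f" "\<And>z. f z \<in> {0..1}"
    "\<And>z. z \<notin> U \<Longrightarrow> f z = 0" "\<And>z. z \<in> K \<Longrightarrow> f z = 1"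
  proof -
    have "normal_space (euclidean :: (nat \<Rightarrow> complex) topology)"
      by (intro metrizable_imp_normal_space metrizable_space_euclidean)
    moreover have "closedin euclidean (- U)" "closedin euclidean K" "disjnt (- U) K"
      using K U by (auto simp: compact_imp_closed disjnt_def)
    ultimately obtain f :: "(nat \<Rightarrow> complex) \<Rightarrow> real"
      where "continuous_map euclidean (top_of_set {0..1}) f" "f ` (- U) \<subseteq> {0}" "f ` K \<subseteq> {1}"
      using Urysohn_lemma[of euclidean "- U" K 0 1] by (metis zero_le_one)
    then show ?thesis by (intro that[of f]) (auto simp: continuous_map_in_subtopology)
  qed
  obtain g where g: "trig_poly d (\<lambda>x. of_real (g x))" "\<And>x. \<bar>f (torus_map d x) - g x\<bar> < e"
    using trig_poly_approximation[OF continuous_on_subset[OF f(1)] e] by blast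
  \<comment> \<open>Raising the approximation by e turns it into a majorant of f, so it is
    nonnegative and at least 1 over K.\<close>
  define F where "F x = g x + e" for x
  have F: "trig_poly d (\<lambda>x. of_real (F x))"
    unfolding F_def of_real_add by (intro trig_poly.add g trig_poly_const)
  have Ff: "f (torus_map d x) \<le> F x" "F x \<le> f (torus_map d x) + 2 * e" for x
    using g(2)[of x] unfolding F_def by linarith+
  have F0: "F x \<ge> 0" for x using Ff(1)[of x] f(2)[of "torus_map d x"] by auto
  have intF: "integrable (cube d) F"
    using integrable_trig_poly[OF F] by (simp only: complex_of_real_integrable_eq)
  define A where "A = torus_map d -` B \<inter> space (cube d)"
  have A: "A \<in> sets (cube d)" unfolding A_def by (rule measurable_sets[OF measurable_torus_map B])
  have "p - e < measure \<nu> K" by (rule Kp)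
  also have "measure \<nu> K = measure (cube d) (torus_map d -` K \<inter> space (cube d))"
    unfolding \<nu>_def by (rule measure_distr) (use Kb in auto)
  also have "\<dots> = (\<integral>x. indicator (torus_map d -` K \<inter> space (cube d)) x \<partial>cube d)"
    by (simp add: Int_absorb2)
  also have "\<dots> \<le> (\<integral>x. indicator A x * F x \<partial>cube d)"
  proof (rule integral_mono)
    show "integrable (cube d) (indicat_real (torus_map d -` K \<inter> space (cube d)))"
      using measurable_sets[OF measurable_torus_map Kb]
          by (intro integrable_real_indicator) (auto simp: cube.emeasure_eq_measure)
    show "integrable (cube d) (\<lambda>x. indicator A x * F x)"
      using integrable_mult_indicator[OF A intF] by simp
    fix x
    show "indicat_real (torus_map d -` K \<inter> space (cube d)) x \<le> indicator A x * F x"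
      using K(1) F0[of x] Ff(1)[of x] f(4)[of "torus_map d x"] by (auto simp: indicator_def A_def)
  qed
  also have "\<dots> \<le> 15 / 16 * (\<integral>x. F x \<partial>cube d)"
    by (rule integral_on_avoiding_set_le[OF d a F F0 A, of N0])
      (auto simp: A_def B_def avoiding_def weyl_poly_torus_map)
  also have "(\<integral>x. F x \<partial>cube d)
      \<le> (\<integral>x. indicator (torus_map d -` U \<inter> space (cube d)) x + 2 * e \<partial>cube d)"
  proof (rule integral_mono[OF intF])
    show "integrable (cube d) (\<lambda>x. indicat_real (torus_map d -` U \<inter> space (cube d)) x + 2 * e)"
      using measurable_sets[OF measurable_torus_map Ub]
      by (intro Bochner_Integration.integrable_add integrable_real_indicator)
          (auto simp: cube.emeasure_eq_measure)
    fix x assume "x \<in> space (cube d)"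
    then show "F x \<le> indicat_real (torus_map d -` U \<inter> space (cube d)) x + 2 * e"
      using Ff(2)[of x] f(2)[of "torus_map d x"] f(3)[of "torus_map d x"]
          by (auto simp: indicator_def)
  qed
  also have "\<dots> = measure (cube d) (torus_map d -` U \<inter> space (cube d)) + 2 * e"
    using measurable_sets[OF measurable_torus_map Ub]
    by (subst Bochner_Integration.integral_add)
       (auto simp: Int_absorb2 cube.prob_space cube.emeasure_eq_measure intro!: integrable_real_indicator)
  also have "measure (cube d) (torus_map d -` U \<inter> space (cube d)) = measure \<nu> U"
    unfolding \<nu>_def by (rule measure_distr[symmetric]) (use Ub in auto)
  also have "measure \<nu> U < p + e" by (rule Up)
  finally have "p - e < 15 / 16 * (p + e + 2 * e)" by simp
  then show False using p by (simp add: e_def)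
qed

lemma emeasure_sqrt_size_set: "emeasure (lebesgue_dim d) (sqrt_size_set a (1 / 2) 2 d) = 1"
proof -
  let ?P = "\<Pi>\<^sub>M i\<in>{1..d}. lborel :: real measure" and ?Q = "{1..d} \<rightarrow>\<^sub>E {0..<1::real}"
  define X where "X = (\<Union>N0. torus_map d -` avoiding N0 \<inter> space (cube d))"
  have avoid_sets: "torus_map d -` avoiding N0 \<inter> space (cube d) \<in> sets (cube d)" for N0
    by (rule measurable_sets[OF measurable_torus_map avoiding_borel])
  have X: "X \<in> sets (cube d)" unfolding X_def by (intro sets.countable_UN) (use avoid_sets in blast)
  have "emeasure (cube d) (torus_map d -` avoiding N0 \<inter> space (cube d)) = 0" for N0
    using null_avoiding[of N0] by (simp add: measure_distr cube.emeasure_eq_measure)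
  then have "emeasure (cube d) X = 0"
    unfolding X_def using avoid_sets by (intro emeasure_UN_eq_0) auto
  then have "measure (cube d) X = 0" by (simp add: measure_def)
  then have compl: "emeasure (cube d) (space (cube d) - X) = 1"
    using cube.prob_compl[OF X] by (simp add: cube.emeasure_eq_measure)
  \<comment> \<open>Failure for infinitely many N means avoidance from some \<open>N0\<close> on, so
    the bad points form the countable union \<open>X\<close>.\<close>
  have eq: "sqrt_size_set a (1 / 2) 2 d = ?Q \<inter> (space (cube d) - X)"
  proof -
    have "x \<in> X \<longleftrightarrow> x \<in> space (cube d) \<and> \<not> (\<exists>\<^sub>\<infinity>N. 1 / 2 * sqrt (real N) \<le> norm (weyl_sum a d x N) \<and>
        norm (weyl_sum a d x N) \<le> 2 * sqrt (real N))" for x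
      unfolding X_def avoiding_def INFM_nat_le by (simp add: weyl_poly_torus_map) blast
    moreover have "?Q \<subseteq> space (cube d)" by (simp add: space_cube PiE_mono)
    ultimately show ?thesis unfolding sqrt_size_set_def by blast
  qed
  have mem: "space (cube d) - X \<in> sets ?P" using X sets.compl_sets[of X "cube d"]
      by (metis sets_cube)
  \<comment> \<open>The set belongs to the product sigma-algebra itself, where the completed measure
    agrees with the product measure.\<close>
  have "emeasure (lebesgue_dim d) (sqrt_size_set a (1 / 2) 2 d)
      = emeasure ?P (?Q \<inter> (space (cube d) - X))"
    unfolding lebesgue_dim_def eq
    using sets.Int[OF unit_cube_in_sets mem] by (simp add: sets_completionI_sets)
  also have "\<dots> = emeasure (cube d) (space (cube d) - X)" by (rule emeasure_cube[OF mem, symmetric])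
  finally show ?thesis using compl by simp
qed

end

theorem theorem2p3:
  "\<exists>c C :: real. c > 0 \<and> C > 0 \<and>
     (\<forall>d::nat. d \<ge> 2 \<longrightarrow>
       (\<forall>a :: nat \<Rightarrow> complex. (\<forall>n\<ge>1. norm (a n) = 1) \<longrightarrow>
         emeasure (lebesgue_dim d) (sqrt_size_set a c C d) = 1))"
  using emeasure_sqrt_size_set by (intro exI[of _ "1 / 2"] exI[of _ 2]) auto

end
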